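(* Let $q$ be any prime power, let $K=GF(q)$ and $F=GF(q^3)$ (so $K$ is a subfield of $F$), let $\xi$ be any primitive element of $F$ (a generator of the cyclic group $F^*$), and let $G=F^*/K^*$. Let $S=\{\xi K^*\}\cup\{(1+t\xi)K^*:\ t\in K\}\subseteq G$. Define the graph $\mathrm{Diff}(q)$ with vertex set $G$, in which two distinct vertices $gK^*,hK^*$ are adjacent if and only if $(gK^* )(hK^* )=ghK^*\in S$. Define the Brown graph $B(q)$ whose vertices are the points of the projective plane $PG(2,q)$, i.e. nonzero vectors $\overline{x}=(x_0,x_1,x_2)\in K^3$ up to nonzero scalar multiples, in which two distinct vertices represented by $\overline{x},\overline{y}$ are adjacent if and only if $x_0y_0+x_1y_1+x_2y_2=0$. Then $\mathrm{Diff}(q)$ and $B(q)$ are isomorphic graphs.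
   Context: Loops are suppressed in both graphs: a vertex is never adjacent to itself. The set $S$ is a perfect difference set in the cyclic group $G$ of order $q^2+q+1$. *)

theory Defs
  imports
    "HOL-Algebra.Multiplicative_Group"
    "HOL-Algebra.Subrings"
    "HOL-Number_Theory.Prime_Powers"
    "Graph_Theory.Pair_Digraph"
    "Graph_Theory.Digraph_Isomorphism"
begin

text \<open>
  A simple graph is represented as a loop-free pair digraph whose arc set is the (symmetric)
  adjacency relation. Both arc sets below are symmetric because multiplication in the underlying field commutes.
\<close>

definition primitive_element :: "('a, 'm) ring_scheme \<Rightarrow> 'a \<Rightarrow> bool" where
  "primitive_element F \<xi> \<longleftrightarrow>
     \<xi> \<in> carrier (mult_of F) \<and> generate (mult_of F) {\<xi>} = carrier (mult_of F)"

definition diff_group :: "('a, 'm) ring_scheme \<Rightarrow> 'a set \<Rightarrow> 'a set monoid" where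
  "diff_group F K = mult_of F Mod (K - {\<zero>\<^bsub>F\<^esub>})"

definition diff_class :: "('a, 'm) ring_scheme \<Rightarrow> 'a set \<Rightarrow> 'a \<Rightarrow> 'a set" where
  "diff_class F K x = (K - {\<zero>\<^bsub>F\<^esub>}) #>\<^bsub>mult_of F\<^esub> x"

definition diff_set :: "('a, 'm) ring_scheme \<Rightarrow> 'a set \<Rightarrow> 'a \<Rightarrow> 'a set set" where
  "diff_set F K \<xi> =
     {diff_class F K \<xi>} \<union> {diff_class F K (\<one>\<^bsub>F\<^esub> \<oplus>\<^bsub>F\<^esub> t \<otimes>\<^bsub>F\<^esub> \<xi>) | t. t \<in> K}"

definition diff_graph ::
  "('a, 'm) ring_scheme \<Rightarrow> 'a set \<Rightarrow> 'a \<Rightarrow> 'a set pair_pre_digraph" where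
  "diff_graph F K \<xi> =
     \<lparr> pverts = carrier (diff_group F K),
       parcs = {(a, b). a \<in> carrier (diff_group F K) \<and> b \<in> carrier (diff_group F K) \<and>
                        a \<noteq> b \<and> a \<otimes>\<^bsub>diff_group F K\<^esub> b \<in> diff_set F K \<xi>} \<rparr>"

definition nonzero_vecs :: "('a, 'm) ring_scheme \<Rightarrow> ('a \<times> 'a \<times> 'a) set" where
  "nonzero_vecs R =
     carrier R \<times> carrier R \<times> carrier R - {(\<zero>\<^bsub>R\<^esub>, \<zero>\<^bsub>R\<^esub>, \<zero>\<^bsub>R\<^esub>)}"

fun scale_vec :: "('a, 'm) ring_scheme \<Rightarrow> 'a \<Rightarrow> 'a \<times> 'a \<times> 'a \<Rightarrow> 'a \<times> 'a \<times> 'a" where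
  "scale_vec R c (x0, x1, x2) = (c \<otimes>\<^bsub>R\<^esub> x0, c \<otimes>\<^bsub>R\<^esub> x1, c \<otimes>\<^bsub>R\<^esub> x2)"

fun dot_vec :: "('a, 'm) ring_scheme \<Rightarrow> 'a \<times> 'a \<times> 'a \<Rightarrow> 'a \<times> 'a \<times> 'a \<Rightarrow> 'a" where
  "dot_vec R (x0, x1, x2) (y0, y1, y2) =
     x0 \<otimes>\<^bsub>R\<^esub> y0 \<oplus>\<^bsub>R\<^esub> x1 \<otimes>\<^bsub>R\<^esub> y1 \<oplus>\<^bsub>R\<^esub> x2 \<otimes>\<^bsub>R\<^esub> y2"

definition proportional :: "('a, 'm) ring_scheme \<Rightarrow> (('a \<times> 'a \<times> 'a) \<times> ('a \<times> 'a \<times> 'a)) set" where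
  "proportional R =
     {(x, y). x \<in> nonzero_vecs R \<and> y \<in> nonzero_vecs R \<and>
              (\<exists>c \<in> carrier R - {\<zero>\<^bsub>R\<^esub>}. y = scale_vec R c x)}"

definition proj_points :: "('a, 'm) ring_scheme \<Rightarrow> ('a \<times> 'a \<times> 'a) set set" where
  "proj_points R = nonzero_vecs R // proportional R"

text \<open>
  Over a field, whether the dot product vanishes does not depend on the representatives, so the
  existential quantifiers in the arc set could equivalently be universal.
\<close>

definition brown_graph :: "('a, 'm) ring_scheme \<Rightarrow> ('a \<times> 'a \<times> 'a) set pair_pre_digraph" where
  "brown_graph R =
     \<lparr> pverts = proj_points R,
       parcs = {(X, Y). X \<in> proj_points R \<and> Y \<in> proj_points R \<and> X \<noteq> Y \<and>
                        (\<exists>x \<in> X. \<exists>y \<in> Y. dot_vec R x y = \<zero>\<^bsub>R\<^esub>)} \<rparr>"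

end

theory Submission
  imports Defs
begin

text \<open>
  Since \<open>\<xi>\<close> is primitive, \<open>1, \<xi>, \<xi>\<^sup>2\<close> is a \<open>K\<close>-basis of \<open>F\<close>. Let \<open>L\<close> be the coefficient of \<open>\<xi>\<^sup>2\<close>. Then
  \<open>S\<close> is the image in \<open>G\<close> of the nonzero elements of \<open>ker L\<close>, so adjacency in \<open>Diff(q)\<close> is orthogonality
  for the symmetric bilinear form \<open>L(x y)\<close>. Using that \<open>-1\<close> is a sum of two squares in \<open>K\<close>, one finds
  a basis with Gram matrix \<open>-I\<close>; in its coordinates adjacency becomes vanishing of the dot product.
\<close>

section \<open>Isomorphisms of pair digraphs\<close>

text \<open>An arc of a pair digraph is the pair of its ends, so a vertex map \<open>f\<close>
  forces the arc map \<open>map_prod f f\<close>, with \<open>fst\<close> and \<open>snd\<close> as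
  tail and head again. Since arcs run between vertices, injectivity on vertices carries over to
  arcs.\<close>

lemma digraph_iso_with_projI:
  assumes bij: "bij_betw f (pverts G) (pverts H)"
    and G: "parcs G \<subseteq> pverts G \<times> pverts G" and H: "parcs H \<subseteq> pverts H \<times> pverts H"
    and arcs: "\<And>a b. \<lbrakk>a \<in> pverts G; b \<in> pverts G\<rbrakk> \<Longrightarrow> (a, b) \<in> parcs G \<longleftrightarrow> (f a, f b) \<in> parcs H"
  shows "digraph_iso (with_proj G) (with_proj H)"
proof -
  define h where "h = \<lparr>iso_verts = f, iso_arcs = map_prod f f, iso_head = snd, iso_tail = fst\<rparr>"
  have inj: "inj_on f (pverts G)" and img: "f ` pverts G = pverts H"
    using bij by (auto simp: bij_betw_def)
  have "inj_on (map_prod f f) (parcs G)"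
    using map_prod_inj_on[OF inj inj] G by (rule inj_on_subset)
  moreover have "wf_digraph (with_proj G)"
    using G by unfold_locales auto
  ultimately have "pre_digraph.digraph_isomorphism (with_proj G) h"
    using inj by (auto simp: pre_digraph.digraph_isomorphism_def h_def)
  moreover have "map_prod f f ` parcs G = parcs H"
  proof
    show "map_prod f f ` parcs G \<subseteq> parcs H" using G arcs by fastforce
    show "parcs H \<subseteq> map_prod f f ` parcs G"
    proof
      fix e assume e: "e \<in> parcs H"
      then have "fst e \<in> f ` pverts G" "snd e \<in> f ` pverts G" using H img by auto
      then obtain a b where "a \<in> pverts G" "b \<in> pverts G" "e = (f a, f b)"
        by (metis imageE prod.collapse)
      with e arcs show "e \<in> map_prod f f ` parcs G" by force
    qed
  qed
  then have "with_proj H = app_iso h (with_proj G)"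
    using img by (simp add: app_iso_def h_def with_proj_def)
  ultimately show ?thesis unfolding digraph_iso_def by blast
qed

section \<open>Squares in finite fields\<close>

lemma (in field) square_eq_iff:
  assumes "x \<in> carrier R" "y \<in> carrier R"
  shows "x \<otimes> x = y \<otimes> y \<longleftrightarrow> x = y \<or> x = \<ominus> y"
proof
  assume eq: "x \<otimes> x = y \<otimes> y"
  have "(x \<oplus> \<ominus> y) \<otimes> (x \<oplus> y) = x \<otimes> x \<oplus> \<ominus> (y \<otimes> y)"
    using assms by algebra
  also have "\<dots> = \<zero>" using eq assms by (simp add: r_neg)
  finally have "x \<oplus> \<ominus> y = \<zero> \<or> x \<oplus> y = \<zero>"
    using assms integral by simp
  then show "x = y \<or> x = \<ominus> y"
  proof
    assume "x \<oplus> \<ominus> y = \<zero>"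
    then have "x \<ominus> y = \<zero>" by (simp add: a_minus_def)
    then show ?thesis using assms by simp
  next
    assume "x \<oplus> y = \<zero>"
    then show ?thesis using minus_equality[of x y] assms by simp
  qed
next
  assume "x = y \<or> x = \<ominus> y"
  then show "x \<otimes> x = y \<otimes> y" using assms by (auto simp: l_minus r_minus)
qed

text \<open>A nonzero square has at most two roots and zero only one, so a field with
  \<open>s\<close> squares has at most \<open>1 + 2 (s - 1)\<close> elements. The single root of
  zero makes the bound strict in every characteristic.\<close>

lemma (in field) card_less_double_squares:
  assumes fin: "finite (carrier R)"
  shows "card (carrier R) < 2 * card ((\<lambda>x. x \<otimes> x) ` carrier R)"
proof -
  let ?sq = "(\<lambda>x. x \<otimes> x)" and ?Q = "(\<lambda>x. x \<otimes> x) ` carrier R"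
  have finQ: "finite ?Q" and zero: "\<zero> \<in> ?Q" using fin by (auto intro: rev_image_eqI[of \<zero>])
  have fib: "card {x \<in> carrier R. x \<otimes> x = s} \<le> 2" if s: "s \<in> ?Q - {\<zero>}" for s
  proof -
    obtain y where y: "y \<in> carrier R" "s = y \<otimes> y" using s by auto
    then have "{x \<in> carrier R. x \<otimes> x = s} \<subseteq> {y, \<ominus> y}"
      using square_eq_iff by auto
    then have "card {x \<in> carrier R. x \<otimes> x = s} \<le> card {y, \<ominus> y}"
      by (intro card_mono) auto
    also have "\<dots> \<le> 2" by (simp add: card_insert_if)
    finally show ?thesis .
  qed
  have "carrier R \<subseteq> insert \<zero> (\<Union>s\<in>?Q - {\<zero>}. {x \<in> carrier R. x \<otimes> x = s})"
    using integral by auto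
  then have "card (carrier R) \<le> card (insert \<zero> (\<Union>s\<in>?Q - {\<zero>}. {x \<in> carrier R. x \<otimes> x = s}))"
    using fin by (intro card_mono) (auto intro: finite_subset[OF _ fin])
  also have "\<dots> \<le> Suc (card (\<Union>s\<in>?Q - {\<zero>}. {x \<in> carrier R. x \<otimes> x = s}))"
    by (rule card_insert_le_m1) auto
  also have "\<dots> \<le> Suc (\<Sum>s\<in>?Q - {\<zero>}. card {x \<in> carrier R. x \<otimes> x = s})"
    using finQ by (simp add: card_UN_le)
  also have "\<dots> \<le> Suc (\<Sum>s\<in>?Q - {\<zero>}. 2)"
    using fib by (simp only: Suc_le_mono) (rule sum_mono, simp)
  also have "\<dots> = Suc (2 * (card ?Q - 1))" using zero finQ by simp
  also have "\<dots> < 2 * card ?Q"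
  \<comment> \<open>The subtraction in \<open>card ?Q - 1\<close> is truncated, so the strict
    inequality needs \<open>?Q\<close> to be nonempty.\<close>
  proof -
    have "card ?Q > 0" using zero finQ by (auto simp: card_gt_0_iff)
    then show ?thesis by linarith
  qed
  finally show ?thesis .
qed

text \<open>Pigeonhole: the squares and their reflections \<open>z - y\<close> are two sets of equal
  size, each filling more than half of the field, so they meet.\<close>

lemma (in field) sum_of_two_squares:
  assumes fin: "finite (carrier R)" and z: "z \<in> carrier R"
  obtains u v where "u \<in> carrier R" "v \<in> carrier R" "u \<otimes> u \<oplus> v \<otimes> v = z"
proof -
  let ?Q = "(\<lambda>x. x \<otimes> x) ` carrier R" and ?f = "\<lambda>y. z \<ominus> y"
  have Q: "?Q \<subseteq> carrier R" "finite ?Q" using fin by auto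
  have "inj_on ?f ?Q"
  proof (rule inj_onI)
    fix x y assume "x \<in> ?Q" "y \<in> ?Q" and eq: "z \<ominus> x = z \<ominus> y"
    then have xy: "x \<in> carrier R" "y \<in> carrier R" using Q by auto
    then have "x = z \<ominus> (z \<ominus> x)" "y = z \<ominus> (z \<ominus> y)" using z by algebra+
    with eq show "x = y" by simp
  qed
  then have "card (?f ` ?Q) = card ?Q" by (rule card_image)
  then have "card (carrier R) < card ?Q + card (?f ` ?Q)"
    using card_less_double_squares[OF fin] by simp
  moreover have "?Q \<union> ?f ` ?Q \<subseteq> carrier R" using Q z by auto
  ultimately have "?Q \<inter> ?f ` ?Q \<noteq> {}"
    using card_Un_disjoint[of ?Q "?f ` ?Q"] card_mono[OF fin, of "?Q \<union> ?f ` ?Q"] Q by force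
  then obtain u v where uv: "u \<in> carrier R" "v \<in> carrier R" "u \<otimes> u = z \<ominus> v \<otimes> v" by auto
  then have "u \<otimes> u \<oplus> v \<otimes> v = z \<ominus> v \<otimes> v \<oplus> v \<otimes> v" by simp
  also have "\<dots> = z" using uv z by algebra
  finally show ?thesis using that uv by blast
qed

text \<open>In characteristic 2 squaring is injective, hence onto, and \<open>r = 0\<close> works.
  Otherwise 2 is invertible and \<open>t = 0\<close> works. Stating both cases as one equation lets
  the later change of basis avoid a case distinction.\<close>

lemma (in field) square_plus_double:
  assumes fin: "finite (carrier R)" and z: "z \<in> carrier R"
  obtains t r where "t \<in> carrier R" "r \<in> carrier R" "t \<otimes> t \<oplus> (r \<oplus> r) = z"
proof (cases "\<one> \<oplus> \<one> = \<zero>")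
  case True
  have neg: "\<ominus> x = x" if "x \<in> carrier R" for x
  proof -
    have "x \<oplus> x = (\<one> \<oplus> \<one>) \<otimes> x" using that by algebra
    then show ?thesis using True that by (simp add: minus_equality)
  qed
  have "inj_on (\<lambda>x. x \<otimes> x) (carrier R)"
  proof (rule inj_onI)
    fix x y assume "x \<in> carrier R" "y \<in> carrier R" "x \<otimes> x = y \<otimes> y"
    then show "x = y" using square_eq_iff[of x y] neg[of y] by metis
  qed
  then have "(\<lambda>x. x \<otimes> x) ` carrier R = carrier R"
    by (intro endo_inj_surj fin) auto
  with z have "z \<in> (\<lambda>x. x \<otimes> x) ` carrier R" by (simp only:)
  then obtain t where "t \<in> carrier R" "t \<otimes> t = z" by blast
  then show ?thesis using that[of t \<zero>] z by simp
next
  case False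
  then have U: "\<one> \<oplus> \<one> \<in> Units R" by (simp add: field_Units)
  define r where "r = inv (\<one> \<oplus> \<one>) \<otimes> z"
  have r: "r \<in> carrier R" using U z by (simp add: r_def)
  have "r \<oplus> r = (\<one> \<oplus> \<one>) \<otimes> r" using r by algebra
  also have "\<dots> = z" using U z by (simp add: r_def m_assoc[symmetric])
  finally show ?thesis using that[of \<zero> r] r z by simp
qed

section \<open>The basis formed by the first three powers of \<open>\<xi>\<close>\<close>

text \<open>In a finite group the elements generated by \<open>\<xi>\<close> are its powers with
  natural exponents, so closure under multiplication by \<open>\<xi>\<close> alone suffices to reach
  them all from \<open>\<one>\<close>. Applied to a small subspace \<open>V\<close>, this gives a
  contradiction by counting.\<close>

lemma (in field) generator_orbit:
  assumes fin: "finite (carrier R)" and prim: "primitive_element R \<xi>"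
    and V: "\<zero> \<in> V" "\<one> \<in> V" "\<And>x. x \<in> V \<Longrightarrow> \<xi> \<otimes> x \<in> V" "V \<subseteq> carrier R"
  shows "carrier R \<subseteq> V"
proof
  interpret M: group "mult_of R" by (rule field_mult_group)
  have \<xi>: "\<xi> \<in> carrier (mult_of R)" using prim by (simp add: primitive_element_def)
  fix x assume x: "x \<in> carrier R"
  have pow: "\<xi> [^] n \<in> V" for n :: nat
  proof (induction n)
    case (Suc n)
    then have "\<xi> \<otimes> \<xi> [^] n \<in> V" by (rule V(3))
    then show ?case using \<xi> by (simp add: m_comm)
  qed (simp add: V)
  show "x \<in> V"
  proof (cases "x = \<zero>")
    case False
    then have "x \<in> generate (mult_of R) {\<xi>}"
      using x prim by (simp add: primitive_element_def)
    then obtain n :: nat where "x = \<xi> [^]\<^bsub>mult_of R\<^esub> n"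
      using M.generate_pow_on_finite_carrier[OF finite_mult_of[OF fin] \<xi>] by blast
    then show ?thesis using pow by (simp add: nat_pow_mult_of)
  qed (simp add: V)
qed

fun quadratic :: "('a, 'm) ring_scheme \<Rightarrow> 'a \<Rightarrow> 'a \<times> 'a \<times> 'a \<Rightarrow> 'a" where
  "quadratic R \<xi> (c0, c1, c2) = c0 \<oplus>\<^bsub>R\<^esub> c1 \<otimes>\<^bsub>R\<^esub> \<xi> \<oplus>\<^bsub>R\<^esub> c2 \<otimes>\<^bsub>R\<^esub> (\<xi> \<otimes>\<^bsub>R\<^esub> \<xi>)"

text \<open>This is the linear span over \<open>K\<close> of \<open>\<one>\<close> and
  \<open>\<xi>\<close>. The classes of its nonzero elements will turn out to be exactly the
  difference set.\<close>

definition affine_span :: "('a, 'm) ring_scheme \<Rightarrow> 'a set \<Rightarrow> 'a \<Rightarrow> 'a set" where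
  "affine_span R K \<xi> = {a \<oplus>\<^bsub>R\<^esub> b \<otimes>\<^bsub>R\<^esub> \<xi> | a b. a \<in> K \<and> b \<in> K}"

locale cubic_extension = field F for F (structure) +
  fixes K :: "'a set" and \<xi> :: 'a
  assumes subfield: "subfield K F"
    and finite_carrier: "finite (carrier F)"
    and card_carrier: "card (carrier F) = card K ^ 3"
    and primitive: "primitive_element F \<xi>"
begin

lemma xi_closed [simp]: "\<xi> \<in> carrier F"
  using primitive by (simp add: primitive_element_def)

lemma K_carrier [simp]: "x \<in> K \<Longrightarrow> x \<in> carrier F"
  using subfieldE(3)[OF subfield] by auto

lemma K_closed [simp]:
  "\<zero> \<in> K" "\<one> \<in> K"
  "x \<in> K \<Longrightarrow> \<ominus> x \<in> K"
  "\<lbrakk>x \<in> K; y \<in> K\<rbrakk> \<Longrightarrow> x \<oplus> y \<in> K"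
  "\<lbrakk>x \<in> K; y \<in> K\<rbrakk> \<Longrightarrow> x \<ominus> y \<in> K"
  "\<lbrakk>x \<in> K; y \<in> K\<rbrakk> \<Longrightarrow> x \<otimes> y \<in> K"
  using subringE[OF subfieldE(1)[OF subfield]] by (auto simp: a_minus_def)

lemma K_inv [simp]: "\<lbrakk>x \<in> K; x \<noteq> \<zero>\<rbrakk> \<Longrightarrow> inv x \<in> K"
  using subfield_m_inv(1)[OF subfield, of x] by auto

lemma K_inv_cancel: "\<lbrakk>x \<in> K; x \<noteq> \<zero>\<rbrakk> \<Longrightarrow> inv x \<otimes> x = \<one>"
  using subfield_m_inv(3)[OF subfield, of x] by auto

lemma finite_K [simp]: "finite K"
  using finite_subset[OF subfieldE(3)[OF subfield] finite_carrier] .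

lemma two_le_card_K: "2 \<le> card K"
proof -
  have "card {\<zero>, \<one>} \<le> card K" by (rule card_mono) auto
  then show ?thesis using one_not_zero by (simp add: card_insert_if)
qed

text \<open>Otherwise \<open>K\<close> is closed under multiplication by \<open>\<xi>\<close> and
  contains all of \<open>F\<close>, although \<open>card K ^ 3\<close> exceeds
  \<open>card K\<close>.\<close>

lemma xi_notin_K: "\<xi> \<notin> K"
proof
  assume "\<xi> \<in> K"
  then have "carrier F \<subseteq> K"
    by (intro generator_orbit[OF finite_carrier primitive]) auto
  then have "card (carrier F) \<le> card K" by (rule card_mono[OF finite_K])
  then have "card K ^ 3 \<le> card K ^ 1" by (simp add: card_carrier)
  then show False using two_le_card_K power_increasing_iff[of "card K" 3 1] by simp
qed

lemma affine_spanI: "\<lbrakk>a \<in> K; b \<in> K\<rbrakk> \<Longrightarrow> a \<oplus> b \<otimes> \<xi> \<in> affine_span F K \<xi>"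
  by (auto simp: affine_span_def)

lemma affine_span_closed: "affine_span F K \<xi> \<subseteq> carrier F"
  by (auto simp: affine_span_def)

text \<open>A quadratic relation for \<open>\<xi>\<close> would make the span of
  \<open>\<one>\<close> and \<open>\<xi>\<close> closed under multiplication by
  \<open>\<xi>\<close>, hence equal to \<open>F\<close>; but it has at most
  \<open>card K ^ 2\<close> elements.\<close>

lemma xi_square_notin_affine_span: "\<xi> \<otimes> \<xi> \<notin> affine_span F K \<xi>"
proof
  let ?W = "affine_span F K \<xi>"
  assume "\<xi> \<otimes> \<xi> \<in> ?W"
  then obtain c d where cd: "c \<in> K" "d \<in> K" "\<xi> \<otimes> \<xi> = c \<oplus> d \<otimes> \<xi>"
    by (auto simp: affine_span_def)
  have "\<xi> \<otimes> x \<in> ?W" if "x \<in> ?W" for x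
  proof -
    obtain a b where ab: "a \<in> K" "b \<in> K" "x = a \<oplus> b \<otimes> \<xi>"
      using \<open>x \<in> ?W\<close> by (auto simp: affine_span_def)
    have "\<xi> \<otimes> x = a \<otimes> \<xi> \<oplus> b \<otimes> (\<xi> \<otimes> \<xi>)"
      using ab K_carrier xi_closed by algebra
    also have "\<dots> = a \<otimes> \<xi> \<oplus> b \<otimes> (c \<oplus> d \<otimes> \<xi>)" by (simp only: cd(3))
    also have "\<dots> = b \<otimes> c \<oplus> (a \<oplus> b \<otimes> d) \<otimes> \<xi>"
      using ab(1,2) cd(1,2)[THEN K_carrier] K_carrier xi_closed by algebra
    finally show ?thesis using ab cd by (simp add: affine_spanI)
  qed
  moreover have "a \<in> ?W" if "a \<in> K" for a
    using affine_spanI[OF that, of \<zero>] that by simp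
  ultimately have "carrier F \<subseteq> ?W"
    using affine_span_closed by (intro generator_orbit[OF finite_carrier primitive]) auto
  moreover have W: "?W = (\<lambda>(a, b). a \<oplus> b \<otimes> \<xi>) ` (K \<times> K)"
    by (auto simp: affine_span_def)
  ultimately have "card (carrier F) \<le> card ((\<lambda>(a, b). a \<oplus> b \<otimes> \<xi>) ` (K \<times> K))"
    by (intro card_mono) auto
  also have "\<dots> \<le> card (K \<times> K)" by (rule card_image_le) simp
  finally have "card K ^ 3 \<le> card K ^ 2"
    by (simp add: card_carrier card_cartesian_product power2_eq_square)
  then show False using two_le_card_K power_increasing_iff[of "card K" 3 2] by simp
qed

lemma quadratic_closed [simp]: "x \<in> K \<times> K \<times> K \<Longrightarrow> quadratic F \<xi> x \<in> carrier F"
  by (cases x) auto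

text \<open>Linear independence, from the top down: a nonzero \<open>c2\<close> would put the square
  of \<open>\<xi>\<close> into the span of \<open>\<one>\<close> and \<open>\<xi>\<close>, and then
  a nonzero \<open>c1\<close> would put \<open>\<xi>\<close> into \<open>K\<close>.\<close>

lemma quadratic_eq_zero:
  assumes "c0 \<in> K" "c1 \<in> K" "c2 \<in> K" and eq: "quadratic F \<xi> (c0, c1, c2) = \<zero>"
  shows "c0 = \<zero> \<and> c1 = \<zero> \<and> c2 = \<zero>"
proof -
  note [simp] = assms(1-3)
  have c2: "c2 = \<zero>"
  proof (rule ccontr)
    assume c2: "c2 \<noteq> \<zero>"
    define d where "d = inv c2"
    have d: "d \<in> K" "d \<in> carrier F" "d \<otimes> c2 = \<one>" using c2 K_inv_cancel by (auto simp: d_def)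
    note C = d(2) assms(1-3)[THEN K_carrier] xi_closed
    \<comment> \<open>Writing \<open>\<one>\<close> as \<open>d \<otimes> c2\<close> turns the next
      equality into a polynomial identity in which \<open>d\<close> need not be known as an
      inverse.\<close>
    have "\<xi> \<otimes> \<xi> = (d \<otimes> c2) \<otimes> (\<xi> \<otimes> \<xi>)" using d by simp
    also have "\<dots> = d \<otimes> (c0 \<oplus> c1 \<otimes> \<xi> \<oplus> c2 \<otimes> (\<xi> \<otimes> \<xi>)) \<oplus> (\<ominus> (d \<otimes> c0) \<oplus> \<ominus> (d \<otimes> c1) \<otimes> \<xi>)"
      using C by algebra
    also have "\<dots> = \<ominus> (d \<otimes> c0) \<oplus> \<ominus> (d \<otimes> c1) \<otimes> \<xi>"
      using eq d by simp
    finally have "\<xi> \<otimes> \<xi> = \<ominus> (d \<otimes> c0) \<oplus> \<ominus> (d \<otimes> c1) \<otimes> \<xi>" .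
    moreover have "\<ominus> (d \<otimes> c0) \<in> K" "\<ominus> (d \<otimes> c1) \<in> K" using d by simp_all
    ultimately show False using xi_square_notin_affine_span affine_spanI by metis
  qed
  then have lin: "c0 \<oplus> c1 \<otimes> \<xi> = \<zero>" using eq by simp
  have c1: "c1 = \<zero>"
  proof (rule ccontr)
    assume c1: "c1 \<noteq> \<zero>"
    define d where "d = inv c1"
    have d: "d \<in> K" "d \<in> carrier F" "d \<otimes> c1 = \<one>" using c1 K_inv_cancel by (auto simp: d_def)
    note C = d(2) assms(1-3)[THEN K_carrier] xi_closed
    have "\<xi> = (d \<otimes> c1) \<otimes> \<xi>" using d by simp
    also have "\<dots> = d \<otimes> (c0 \<oplus> c1 \<otimes> \<xi>) \<oplus> \<ominus> (d \<otimes> c0)"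
      using C by algebra
    also have "\<dots> = \<ominus> (d \<otimes> c0)" using lin d by simp
    finally have "\<xi> \<in> K" using d by simp
    then show False using xi_notin_K by simp
  qed
  then show ?thesis using c2 lin by simp
qed

lemma quadratic_add:
  assumes "c0 \<in> K" "c1 \<in> K" "c2 \<in> K" "d0 \<in> K" "d1 \<in> K" "d2 \<in> K"
  shows "quadratic F \<xi> (c0, c1, c2) \<oplus> quadratic F \<xi> (d0, d1, d2) =
    quadratic F \<xi> (c0 \<oplus> d0, c1 \<oplus> d1, c2 \<oplus> d2)"
  using assms[THEN K_carrier] xi_closed unfolding quadratic.simps by algebra

lemma quadratic_smult:
  assumes "k \<in> K" "c0 \<in> K" "c1 \<in> K" "c2 \<in> K"
  shows "k \<otimes> quadratic F \<xi> (c0, c1, c2) = quadratic F \<xi> (k \<otimes> c0, k \<otimes> c1, k \<otimes> c2)"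
  using assms[THEN K_carrier] xi_closed unfolding quadratic.simps by algebra

lemma card_K3: "card (K \<times> K \<times> K) = card (carrier F)"
  by (simp add: card_carrier card_cartesian_product power3_eq_cube)

lemma eq_of_minus_zero: "\<lbrakk>x \<in> carrier F; y \<in> carrier F; x \<oplus> \<ominus> y = \<zero>\<rbrakk> \<Longrightarrow> x = y"
  using r_right_minus_eq[of x y] by (simp add: a_minus_def)

text \<open>Independence gives injectivity, and the two finite sets have the same size, so spanning
  comes for free.\<close>

lemma bij_betw_quadratic: "bij_betw (quadratic F \<xi>) (K \<times> K \<times> K) (carrier F)"
proof -
  have "inj_on (quadratic F \<xi>) (K \<times> K \<times> K)"
  proof (rule inj_onI)
    fix x y assume "x \<in> K \<times> K \<times> K" "y \<in> K \<times> K \<times> K" and eq: "quadratic F \<xi> x = quadratic F \<xi> y"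
    then obtain c0 c1 c2 d0 d1 d2 where x: "x = (c0, c1, c2)" and y: "y = (d0, d1, d2)"
      and K: "c0 \<in> K" "c1 \<in> K" "c2 \<in> K" "d0 \<in> K" "d1 \<in> K" "d2 \<in> K" by auto
    have "quadratic F \<xi> (c0 \<oplus> \<ominus> d0, c1 \<oplus> \<ominus> d1, c2 \<oplus> \<ominus> d2) =
        quadratic F \<xi> (c0, c1, c2) \<oplus> \<ominus> quadratic F \<xi> (d0, d1, d2)"
      using K[THEN K_carrier] xi_closed unfolding quadratic.simps by algebra
    also have "\<dots> = \<zero>" using eq K unfolding x y by (simp add: r_neg)
    finally have "c0 \<oplus> \<ominus> d0 = \<zero> \<and> c1 \<oplus> \<ominus> d1 = \<zero> \<and> c2 \<oplus> \<ominus> d2 = \<zero>"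
      using K by (intro quadratic_eq_zero) auto
    then show "x = y" using K eq_of_minus_zero unfolding x y by simp
  qed
  then show ?thesis
    by (metis bij_betw_def card_K3 card_image card_subset_eq finite_carrier image_subsetI quadratic_closed)
qed

section \<open>The functional \<open>top_coeff\<close> and its kernel\<close>

text \<open>This is the functional \<open>L\<close> of the overview. Composed with multiplication it
  gives the symmetric bilinear form whose orthogonality is adjacency.\<close>

definition top_coeff :: "'a \<Rightarrow> 'a" where
  "top_coeff z = snd (snd (the_inv_into (K \<times> K \<times> K) (quadratic F \<xi>) z))"

lemma top_coeff_quadratic [simp]:
  "\<lbrakk>c0 \<in> K; c1 \<in> K; c2 \<in> K\<rbrakk> \<Longrightarrow> top_coeff (quadratic F \<xi> (c0, c1, c2)) = c2"
  using bij_betw_quadratic by (simp add: top_coeff_def the_inv_into_f_f bij_betw_def del: quadratic.simps)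

lemma quadratic_cases:
  assumes "z \<in> carrier F"
  obtains c0 c1 c2 where "c0 \<in> K" "c1 \<in> K" "c2 \<in> K" "z = quadratic F \<xi> (c0, c1, c2)"
proof -
  have "z \<in> quadratic F \<xi> ` (K \<times> K \<times> K)" using assms bij_betw_quadratic by (simp add: bij_betw_def)
  then show ?thesis using that by (auto simp del: quadratic.simps)
qed

lemma top_coeff_closed [simp]: "z \<in> carrier F \<Longrightarrow> top_coeff z \<in> K"
  by (erule quadratic_cases) (simp del: quadratic.simps)

lemma top_coeff_add [simp]:
  "\<lbrakk>y \<in> carrier F; z \<in> carrier F\<rbrakk> \<Longrightarrow> top_coeff (y \<oplus> z) = top_coeff y \<oplus> top_coeff z"
  by (erule quadratic_cases, erule quadratic_cases) (simp add: quadratic_add del: quadratic.simps)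

lemma top_coeff_smult [simp]:
  "\<lbrakk>k \<in> K; z \<in> carrier F\<rbrakk> \<Longrightarrow> top_coeff (k \<otimes> z) = k \<otimes> top_coeff z"
  by (erule quadratic_cases) (simp add: quadratic_smult del: quadratic.simps)

lemma top_coeff_K [simp]: "k \<in> K \<Longrightarrow> top_coeff k = \<zero>"
  using top_coeff_quadratic[of k \<zero> \<zero>] by simp

lemma top_coeff_xi [simp]: "top_coeff \<xi> = \<zero>"
  using top_coeff_quadratic[of \<zero> \<one> \<zero>] by simp

lemma top_coeff_xi_square [simp]: "top_coeff (\<xi> \<otimes> \<xi>) = \<one>"
  using top_coeff_quadratic[of \<zero> \<zero> \<one>] by simp

lemma top_coeff_zero_iff:
  assumes "z \<in> carrier F"
  shows "top_coeff z = \<zero> \<longleftrightarrow> z \<in> affine_span F K \<xi>"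
proof
  assume "z \<in> affine_span F K \<xi>"
  then show "top_coeff z = \<zero>" by (auto simp: affine_span_def)
next
  assume top: "top_coeff z = \<zero>"
  obtain c0 c1 c2 where "c0 \<in> K" "c1 \<in> K" "c2 \<in> K" "z = quadratic F \<xi> (c0, c1, c2)"
    using quadratic_cases[OF assms] .
  with top show "z \<in> affine_span F K \<xi>" by (auto simp: affine_span_def)
qed

section \<open>A basis with Gram matrix \<open>-I\<close>\<close>

lemma field_K: "field (F\<lparr>carrier := K\<rparr>)"
  using subfield_iff(2)[OF subfield] .

lemma K_sum_of_two_squares:
  assumes "z \<in> K"
  obtains u v where "u \<in> K" "v \<in> K" "u \<otimes> u \<oplus> v \<otimes> v = z"
  using field.sum_of_two_squares[OF field_K, of z] assms by auto

lemma K_square_plus_double: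
  assumes "z \<in> K"
  obtains t r where "t \<in> K" "r \<in> K" "t \<otimes> t \<oplus> (r \<oplus> r) = z"
  using field.square_plus_double[OF field_K, of z] assms by auto

text \<open>
  With \<open>a\<close>, \<open>b\<close> the top coefficients of \<open>\<xi>\<^sup>3\<close>, \<open>\<xi>\<^sup>4\<close>, the element \<open>\<xi> - a - t\<close> is orthogonal to
  \<open>\<xi>\<^sup>2 + t \<xi> + (r - t a)\<close>, of norm \<open>b + t\<^sup>2 + 2 r\<close>. In every characteristic the norm
  can be prescribed.
\<close>
lemma gram_normal_form:
  obtains e g where "e \<in> carrier F" "g \<in> carrier F"
    "top_coeff e = \<zero>" "top_coeff g = \<one>"
    "top_coeff (e \<otimes> e) = \<one>" "top_coeff (e \<otimes> g) = \<zero>" "top_coeff (g \<otimes> g) = \<ominus> \<one>"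
proof -
  define a where "a = top_coeff (\<xi> \<otimes> (\<xi> \<otimes> \<xi>))"
  define b where "b = top_coeff (\<xi> \<otimes> (\<xi> \<otimes> (\<xi> \<otimes> \<xi>)))"
  have ab: "a \<in> K" "b \<in> K" by (simp_all add: a_def b_def)
  obtain t r where tr: "t \<in> K" "r \<in> K" "t \<otimes> t \<oplus> (r \<oplus> r) = \<ominus> \<one> \<oplus> \<ominus> b"
    using K_square_plus_double[of "\<ominus> \<one> \<oplus> \<ominus> b"] ab by auto
  \<comment> \<open>\<open>m\<close> solves \<open>a + t + m = 0\<close>, which is the orthogonality
    of \<open>e\<close> and \<open>g\<close>. \<open>n\<close> solves \<open>t a + n = r\<close>, so
    that the cross terms in the norm of \<open>g\<close> add up to \<open>r + r\<close>.\<close>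
  define m n where "m = \<ominus> (a \<oplus> t)" and "n = r \<oplus> \<ominus> (t \<otimes> a)"
  have mn: "m \<in> K" "n \<in> K" using ab tr by (simp_all add: m_def n_def)
  define e g where "e = \<xi> \<oplus> m" and "g = \<xi> \<otimes> \<xi> \<oplus> t \<otimes> \<xi> \<oplus> n"
  note C = ab[THEN K_carrier] tr(1,2)[THEN K_carrier] mn[THEN K_carrier] xi_closed
  have "e \<otimes> e = \<xi> \<otimes> \<xi> \<oplus> (m \<oplus> m) \<otimes> \<xi> \<oplus> m \<otimes> m"
    using C unfolding e_def by algebra
  then have ee: "top_coeff (e \<otimes> e) = \<one>" using mn by simp
  have "e \<otimes> g = \<xi> \<otimes> (\<xi> \<otimes> \<xi>) \<oplus> (t \<oplus> m) \<otimes> (\<xi> \<otimes> \<xi>) \<oplus> (n \<oplus> m \<otimes> t) \<otimes> \<xi> \<oplus> m \<otimes> n"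
    using C unfolding e_def g_def by algebra
  then have "top_coeff (e \<otimes> g) = a \<oplus> (t \<oplus> m)" using mn tr by (simp add: a_def)
  also have "\<dots> = \<zero>" using C unfolding m_def by algebra
  finally have eg: "top_coeff (e \<otimes> g) = \<zero>" .
  \<comment> \<open>Splitting off the leading term lets the square of \<open>g\<close> be expanded
    as a binomial, with each of its three parts evaluated separately.\<close>
  define h where "h = t \<otimes> \<xi> \<oplus> n"
  have h: "h \<in> carrier F" "g = \<xi> \<otimes> \<xi> \<oplus> h" using C by (simp_all add: g_def h_def a_assoc)
  have "(\<xi> \<otimes> \<xi>) \<otimes> h = t \<otimes> (\<xi> \<otimes> (\<xi> \<otimes> \<xi>)) \<oplus> n \<otimes> (\<xi> \<otimes> \<xi>)"
    using C unfolding h_def by algebra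
  then have lh: "top_coeff ((\<xi> \<otimes> \<xi>) \<otimes> h) = t \<otimes> a \<oplus> n" using mn tr by (simp add: a_def)
  have "h \<otimes> h = (t \<otimes> t) \<otimes> (\<xi> \<otimes> \<xi>) \<oplus> (t \<otimes> n \<oplus> t \<otimes> n) \<otimes> \<xi> \<oplus> n \<otimes> n"
    using C unfolding h_def by algebra
  then have hh: "top_coeff (h \<otimes> h) = t \<otimes> t" using mn tr by simp
  have "g \<otimes> g = \<xi> \<otimes> (\<xi> \<otimes> (\<xi> \<otimes> \<xi>)) \<oplus> ((\<xi> \<otimes> \<xi>) \<otimes> h \<oplus> (\<xi> \<otimes> \<xi>) \<otimes> h) \<oplus> h \<otimes> h"
    unfolding h(2) using h(1) xi_closed by algebra
  then have "top_coeff (g \<otimes> g) = b \<oplus> ((t \<otimes> a \<oplus> n) \<oplus> (t \<otimes> a \<oplus> n)) \<oplus> t \<otimes> t"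
    using h(1) by (simp add: b_def lh hh)
  also have "\<dots> = b \<oplus> (t \<otimes> t \<oplus> (r \<oplus> r))" using C unfolding n_def by algebra
  also have "\<dots> = \<ominus> \<one>" unfolding tr(3) using C by algebra
  finally have gg: "top_coeff (g \<otimes> g) = \<ominus> \<one>" .
  show ?thesis
    by (rule that[of e g]) (use ee eg gg mn tr in \<open>simp_all add: e_def g_def\<close>)
qed

lemma top_coeff_distrib:
  assumes "x \<in> carrier F" "y \<in> carrier F" "z \<in> carrier F"
  shows "top_coeff ((x \<oplus> y) \<otimes> z) = top_coeff (x \<otimes> z) \<oplus> top_coeff (y \<otimes> z)"
    and "top_coeff (z \<otimes> (x \<oplus> y)) = top_coeff (z \<otimes> x) \<oplus> top_coeff (z \<otimes> y)"
  using assms by (simp_all add: l_distr r_distr)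

lemma top_coeff_scale:
  assumes "k \<in> K" "x \<in> carrier F" "y \<in> carrier F"
  shows "top_coeff ((k \<otimes> x) \<otimes> y) = k \<otimes> top_coeff (x \<otimes> y)"
    and "top_coeff (x \<otimes> (k \<otimes> y)) = k \<otimes> top_coeff (x \<otimes> y)"
  using assms by (simp_all add: m_assoc m_lcomm)

text \<open>
  If \<open>p\<close>, \<open>e\<close> are orthonormal and \<open>u\<^sup>2 + v\<^sup>2 = -1\<close>, then \<open>u p + v e\<close> and \<open>v p - u e\<close> are orthogonal
  of norm \<open>-1\<close>.
\<close>
lemma negative_orthonormal_basis:
  obtains e0 e1 e2 where "e0 \<in> carrier F" "e1 \<in> carrier F" "e2 \<in> carrier F"
    "top_coeff (e0 \<otimes> e0) = \<ominus> \<one>" "top_coeff (e1 \<otimes> e1) = \<ominus> \<one>" "top_coeff (e2 \<otimes> e2) = \<ominus> \<one>"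
    "top_coeff (e0 \<otimes> e1) = \<zero>" "top_coeff (e0 \<otimes> e2) = \<zero>" "top_coeff (e1 \<otimes> e2) = \<zero>"
proof -
  obtain e g where eg: "e \<in> carrier F" "g \<in> carrier F"
    and top: "top_coeff e = \<zero>" "top_coeff g = \<one>"
      "top_coeff (e \<otimes> e) = \<one>" "top_coeff (e \<otimes> g) = \<zero>" "top_coeff (g \<otimes> g) = \<ominus> \<one>"
    by (rule gram_normal_form)
  obtain u v where uv: "u \<in> K" "v \<in> K" "u \<otimes> u \<oplus> v \<otimes> v = \<ominus> \<one>"
    using K_sum_of_two_squares[of "\<ominus> \<one>"] by auto
  \<comment> \<open>\<open>\<one>\<close> is isotropic, orthogonal to \<open>e\<close>, and pairs to
    \<open>\<one>\<close> with \<open>g\<close>. Hence \<open>p\<close> has norm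
    \<open>0 + 1 + 1 - 1 = 1\<close> and is orthogonal to both \<open>e\<close> and
    \<open>g\<close>: the norms of \<open>p\<close>, \<open>e\<close>, \<open>g\<close> are 1, 1,
    -1.\<close>
  define p where "p = \<one> \<oplus> g"
  have p: "p \<in> carrier F" using eg by (simp add: p_def)
  have pp: "top_coeff (p \<otimes> p) = \<one>" and pe: "top_coeff (p \<otimes> e) = \<zero>" and pg: "top_coeff (p \<otimes> g) = \<zero>"
    using eg top by (simp_all add: p_def top_coeff_distrib m_comm[of g e] r_neg a_assoc)
  obtain w where w: "w \<in> K" "w = \<ominus> u" using uv by simp
  define e0 e1 where "e0 = u \<otimes> p \<oplus> v \<otimes> e" and "e1 = v \<otimes> p \<oplus> w \<otimes> e"
  have C: "e0 \<in> carrier F" "e1 \<in> carrier F" using uv eg p w(1) by (simp_all add: e0_def e1_def)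
  note calc = top_coeff_distrib top_coeff_scale m_comm[OF eg(1) p] pp pe pg top
  note uvC = uv(1,2)[THEN K_carrier]
  have "top_coeff (e0 \<otimes> e0) = u \<otimes> u \<oplus> v \<otimes> v"
    using uv(1,2) eg p by (simp add: e0_def calc)
  moreover have "top_coeff (e1 \<otimes> e1) = v \<otimes> v \<oplus> w \<otimes> w"
    using uv(1,2) w(1) eg p by (simp add: e1_def calc)
  then have "top_coeff (e1 \<otimes> e1) = u \<otimes> u \<oplus> v \<otimes> v"
    using uvC by (simp add: w(2) l_minus r_minus a_comm)
  moreover have "top_coeff (e0 \<otimes> e1) = u \<otimes> v \<oplus> v \<otimes> w"
    using uv(1,2) w(1) eg p by (simp add: e0_def e1_def calc m_comm[of v u] m_comm[of w v])
  then have "top_coeff (e0 \<otimes> e1) = \<zero>"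
    using uvC by (simp add: w(2) r_minus m_comm[of v u] r_neg)
  moreover have "top_coeff (e0 \<otimes> g) = \<zero>" "top_coeff (e1 \<otimes> g) = \<zero>"
    using uv(1,2) w(1) eg p by (simp_all add: e0_def e1_def calc)
  ultimately show ?thesis
    using uv eg C top by (intro that[of e0 e1 g]) simp_all
qed

section \<open>Coordinates that turn the form into the dot product\<close>

fun combination :: "'a \<times> 'a \<times> 'a \<Rightarrow> 'a \<times> 'a \<times> 'a \<Rightarrow> 'a" where
  "combination (e0, e1, e2) (x0, x1, x2) = x0 \<otimes> e0 \<oplus> x1 \<otimes> e1 \<oplus> x2 \<otimes> e2"

lemma combination_closed:
  assumes "e \<in> carrier F \<times> carrier F \<times> carrier F" "x \<in> K \<times> K \<times> K"
  shows "combination e x \<in> carrier F"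
  using assms by (cases e; cases x) auto

lemma combination_scale:
  assumes "e \<in> carrier F \<times> carrier F \<times> carrier F" "x \<in> K \<times> K \<times> K" "c \<in> K"
  shows "combination e (scale_vec F c x) = c \<otimes> combination e x"
  using assms by (cases e; cases x) (auto simp: r_distr m_assoc)

lemma combination_diff:
  assumes "e \<in> carrier F \<times> carrier F \<times> carrier F"
    and "x0 \<in> K" "x1 \<in> K" "x2 \<in> K" "y0 \<in> K" "y1 \<in> K" "y2 \<in> K"
  shows "combination e (x0 \<oplus> \<ominus> y0, x1 \<oplus> \<ominus> y1, x2 \<oplus> \<ominus> y2) =
    combination e (x0, x1, x2) \<oplus> \<ominus> combination e (y0, y1, y2)"
proof -
  obtain e0 e1 e2 where e: "e = (e0, e1, e2)" by (cases e)
  have C: "e0 \<in> carrier F" "e1 \<in> carrier F" "e2 \<in> carrier F" using assms(1) by (simp_all add: e)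
  show ?thesis unfolding e combination.simps using C assms(2-)[THEN K_carrier] by algebra
qed

text \<open>In the basis with Gram matrix \<open>-I\<close> the form is the negated dot product, and
  the sign does not affect vanishing. That the three vectors form a basis is a consequence: the dot
  product is nondegenerate, which gives injectivity, and counting gives the rest.\<close>

lemma polarity_coordinates:
  obtains \<phi> where "bij_betw \<phi> (K \<times> K \<times> K) (carrier F)" "\<phi> (\<zero>, \<zero>, \<zero>) = \<zero>"
    "\<And>c x. \<lbrakk>c \<in> K; x \<in> K \<times> K \<times> K\<rbrakk> \<Longrightarrow> \<phi> (scale_vec F c x) = c \<otimes> \<phi> x"
    "\<And>x y. \<lbrakk>x \<in> K \<times> K \<times> K; y \<in> K \<times> K \<times> K\<rbrakk> \<Longrightarrow>
      \<phi> x \<otimes> \<phi> y \<in> affine_span F K \<xi> \<longleftrightarrow> dot_vec F x y = \<zero>"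
proof -
  obtain e0 e1 e2 where e: "e0 \<in> carrier F" "e1 \<in> carrier F" "e2 \<in> carrier F"
    and top: "top_coeff (e0 \<otimes> e0) = \<ominus> \<one>" "top_coeff (e1 \<otimes> e1) = \<ominus> \<one>"
      "top_coeff (e2 \<otimes> e2) = \<ominus> \<one>" "top_coeff (e0 \<otimes> e1) = \<zero>"
      "top_coeff (e0 \<otimes> e2) = \<zero>" "top_coeff (e1 \<otimes> e2) = \<zero>"
    by (rule negative_orthonormal_basis)
  let ?\<phi> = "combination (e0, e1, e2)"
  have e': "(e0, e1, e2) \<in> carrier F \<times> carrier F \<times> carrier F" using e by simp
  note closed = combination_closed[OF e']
  have dot: "top_coeff (?\<phi> x \<otimes> ?\<phi> y) = \<ominus> dot_vec F x y"
    if "x \<in> K \<times> K \<times> K" "y \<in> K \<times> K \<times> K" for x y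
  proof -
    obtain x0 x1 x2 y0 y1 y2 where xy: "x = (x0, x1, x2)" "y = (y0, y1, y2)"
      and K: "x0 \<in> K" "x1 \<in> K" "x2 \<in> K" "y0 \<in> K" "y1 \<in> K" "y2 \<in> K"
      using \<open>x \<in> _\<close> \<open>y \<in> _\<close> by auto
    have "top_coeff (?\<phi> x \<otimes> ?\<phi> y) = \<ominus> (x0 \<otimes> y0) \<oplus> \<ominus> (x1 \<otimes> y1) \<oplus> \<ominus> (x2 \<otimes> y2)"
      using K e by (simp add: xy top_coeff_distrib top_coeff_scale top r_minus
          m_comm[of y0 x0] m_comm[of y1 x1] m_comm[of y2 x2]
          m_comm[OF e(2) e(1)] m_comm[OF e(3) e(1)] m_comm[OF e(3) e(2)])
    then show ?thesis using K by (simp add: xy minus_add a_assoc)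
  qed
  have iff: "?\<phi> x \<otimes> ?\<phi> y \<in> affine_span F K \<xi> \<longleftrightarrow> dot_vec F x y = \<zero>"
    if xy: "x \<in> K \<times> K \<times> K" "y \<in> K \<times> K \<times> K" for x y
  proof -
    have "dot_vec F x y \<in> carrier F" using xy by (auto split: prod.splits)
    then have "\<ominus> dot_vec F x y = \<zero> \<longleftrightarrow> dot_vec F x y = \<zero>"
      using minus_minus minus_zero by metis
    then show ?thesis
      using top_coeff_zero_iff[of "?\<phi> x \<otimes> ?\<phi> y"] dot xy closed by simp
  qed
  have zero: "x0 = \<zero> \<and> x1 = \<zero> \<and> x2 = \<zero>"
    if K: "x0 \<in> K" "x1 \<in> K" "x2 \<in> K" and 0: "?\<phi> (x0, x1, x2) = \<zero>" for x0 x1 x2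
  proof -
    \<comment> \<open>A vector in the kernel is orthogonal to every \<open>y\<close>; the three unit
      vectors then read off its coordinates.\<close>
    have "dot_vec F (x0, x1, x2) y = \<zero>" if y: "y \<in> K \<times> K \<times> K" for y
    proof -
      have "?\<phi> (x0, x1, x2) \<otimes> ?\<phi> y = \<zero>" using 0 closed[OF y] by simp
      then show ?thesis using iff[of "(x0, x1, x2)" y] K y affine_spanI[of \<zero> \<zero>] by simp
    qed
    from this[of "(\<one>, \<zero>, \<zero>)"] this[of "(\<zero>, \<one>, \<zero>)"] this[of "(\<zero>, \<zero>, \<one>)"]
    show ?thesis using K by simp
  qed
  have "inj_on ?\<phi> (K \<times> K \<times> K)"
  proof (rule inj_onI)
    fix x y assume "x \<in> K \<times> K \<times> K" "y \<in> K \<times> K \<times> K" and eq: "?\<phi> x = ?\<phi> y"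
    then obtain x0 x1 x2 y0 y1 y2 where xy: "x = (x0, x1, x2)" "y = (y0, y1, y2)"
      and K: "x0 \<in> K" "x1 \<in> K" "x2 \<in> K" "y0 \<in> K" "y1 \<in> K" "y2 \<in> K" by auto
    have "?\<phi> y \<in> carrier F" using closed \<open>y \<in> _\<close> .
    then have "?\<phi> x \<oplus> \<ominus> ?\<phi> y = \<zero>" unfolding eq by (rule r_neg)
    then have "?\<phi> (x0 \<oplus> \<ominus> y0, x1 \<oplus> \<ominus> y1, x2 \<oplus> \<ominus> y2) = \<zero>"
      using combination_diff[OF e' K] by (simp only: xy)
    then have "x0 \<oplus> \<ominus> y0 = \<zero> \<and> x1 \<oplus> \<ominus> y1 = \<zero> \<and> x2 \<oplus> \<ominus> y2 = \<zero>"
      using K by (intro zero) auto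
    then show "x = y" using K eq_of_minus_zero unfolding xy by simp
  qed
  then have "bij_betw ?\<phi> (K \<times> K \<times> K) (carrier F)"
    by (metis bij_betw_def card_K3 card_image card_subset_eq finite_carrier image_subsetI closed)
  then show ?thesis
    using combination_scale[OF e'] iff e by (intro that[of ?\<phi>]) auto
qed

section \<open>The quotient group and the difference set\<close>

lemma mem_diff_class: "w \<in> diff_class F K z \<longleftrightarrow> (\<exists>c\<in>K - {\<zero>}. w = c \<otimes> z)"
  by (auto simp: diff_class_def r_coset_def)

lemma diff_class_self: "z \<in> carrier F \<Longrightarrow> z \<in> diff_class F K z"
  unfolding mem_diff_class by (rule bexI[of _ \<one>]) auto

lemma diff_class_smult:
  assumes c: "c \<in> K" "c \<noteq> \<zero>" and z: "z \<in> carrier F"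
  shows "diff_class F K (c \<otimes> z) = diff_class F K z"
proof
  show "diff_class F K (c \<otimes> z) \<subseteq> diff_class F K z"
  proof
    fix w assume "w \<in> diff_class F K (c \<otimes> z)"
    then obtain d where d: "d \<in> K" "d \<noteq> \<zero>" "w = d \<otimes> (c \<otimes> z)" by (auto simp: mem_diff_class)
    then have "w = (d \<otimes> c) \<otimes> z" "d \<otimes> c \<in> K - {\<zero>}"
      using c z by (auto simp: m_assoc integral_iff)
    then show "w \<in> diff_class F K z" unfolding mem_diff_class by blast
  qed
  show "diff_class F K z \<subseteq> diff_class F K (c \<otimes> z)"
  proof
    fix w assume "w \<in> diff_class F K z"
    then obtain d where d: "d \<in> K" "d \<noteq> \<zero>" "w = d \<otimes> z" by (auto simp: mem_diff_class)
    have i: "inv c \<in> K" "inv c \<otimes> c = \<one>" using c K_inv_cancel by simp_all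
    have "w = (d \<otimes> (inv c \<otimes> c)) \<otimes> z" using d i z by simp
    also have "\<dots> = (d \<otimes> inv c) \<otimes> (c \<otimes> z)" using d(1) i(1) c(1) z by (simp add: m_assoc)
    finally have "w = (d \<otimes> inv c) \<otimes> (c \<otimes> z)" .
    moreover have "inv c \<noteq> \<zero>" using i(2) c by auto
    ultimately show "w \<in> diff_class F K (c \<otimes> z)"
      unfolding mem_diff_class using d i by (intro bexI[of _ "d \<otimes> inv c"]) (auto simp: integral_iff)
  qed
qed

lemma diff_class_eq_iff:
  assumes "z \<in> carrier F" "w \<in> carrier F"
  shows "diff_class F K w = diff_class F K z \<longleftrightarrow> w \<in> diff_class F K z"
  using assms diff_class_self[of w] diff_class_smult by (auto simp: mem_diff_class)

lemma carrier_diff_group: "carrier (diff_group F K) = diff_class F K ` (carrier F - {\<zero>})"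
  by (auto simp: diff_group_def diff_class_def FactGroup_def RCOSETS_def)

lemma K_subgroup: "subgroup (K - {\<zero>}) (mult_of F)"
proof -
  interpret M: group "mult_of F" by (rule field_mult_group)
  show ?thesis
  proof (rule M.subgroupI)
    fix a assume a: "a \<in> K - {\<zero>}"
    then have "inv a \<otimes> a = \<one>" "inv a \<in> K" using K_inv_cancel by simp_all
    then show "inv\<^bsub>mult_of F\<^esub> a \<in> K - {\<zero>}" using a by (auto simp: m_inv_mult_of)
  next
    show "K - {\<zero>} \<noteq> {}" using K_closed(2) one_not_zero by blast
  qed (auto simp: integral_iff)
qed

lemma mult_diff_class:
  assumes "y \<in> carrier F - {\<zero>}" "z \<in> carrier F - {\<zero>}"
  shows "diff_class F K y \<otimes>\<^bsub>diff_group F K\<^esub> diff_class F K z = diff_class F K (y \<otimes> z)"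
proof -
  have "comm_group (mult_of F)" unfolding mult_of_is_Units by (rule units_comm_group)
  then have "(K - {\<zero>}) \<lhd> mult_of F"
    using K_subgroup by (rule comm_group.subgroup_imp_normal)
  from normal.rcos_sum[OF this, of y z] assms show ?thesis
    by (simp add: diff_group_def diff_class_def FactGroup_def)
qed

text \<open>The elements listed in the difference set are normalised representatives: a nonzero
  \<open>a + b \<xi>\<close> is a scalar multiple of \<open>\<xi>\<close> if \<open>a\<close>
  vanishes, and otherwise of \<open>1 + t \<xi>\<close> with \<open>t = b / a\<close>.\<close>

lemma diff_class_in_diff_set_iff:
  assumes z: "z \<in> carrier F" "z \<noteq> \<zero>"
  shows "diff_class F K z \<in> diff_set F K \<xi> \<longleftrightarrow> z \<in> affine_span F K \<xi>"
proof
  assume "diff_class F K z \<in> diff_set F K \<xi>"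
  then consider "diff_class F K z = diff_class F K \<xi>"
    | t where "t \<in> K" "diff_class F K z = diff_class F K (\<one> \<oplus> t \<otimes> \<xi>)"
    by (auto simp: diff_set_def)
  then show "z \<in> affine_span F K \<xi>"
  proof cases
    case 1
    then obtain c where "c \<in> K" "z = c \<otimes> \<xi>"
      using z by (auto simp: diff_class_eq_iff mem_diff_class)
    then show ?thesis using affine_spanI[of \<zero> c] by simp
  next
    case 2
    then obtain c where c: "c \<in> K" "z = c \<otimes> (\<one> \<oplus> t \<otimes> \<xi>)"
      using z by (auto simp: diff_class_eq_iff mem_diff_class)
    then have "z = c \<oplus> (c \<otimes> t) \<otimes> \<xi>" using 2 by (simp add: r_distr m_assoc)
    then show ?thesis using affine_spanI[of c "c \<otimes> t"] c 2 by simp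
  qed
next
  assume "z \<in> affine_span F K \<xi>"
  then obtain a b where ab: "a \<in> K" "b \<in> K" "z = a \<oplus> b \<otimes> \<xi>" by (auto simp: affine_span_def)
  show "diff_class F K z \<in> diff_set F K \<xi>"
  proof (cases "a = \<zero>")
    case True
    then have "z = b \<otimes> \<xi>" "b \<noteq> \<zero>" using ab z by auto
    then show ?thesis using ab diff_class_smult[of b \<xi>] by (simp add: diff_set_def)
  next
    case False
    have i: "inv a \<in> K" "inv a \<otimes> a = \<one>" using ab False K_inv_cancel by simp_all
    have "z = a \<oplus> ((inv a \<otimes> a) \<otimes> b) \<otimes> \<xi>" using ab i by simp
    also have "\<dots> = a \<otimes> (\<one> \<oplus> (inv a \<otimes> b) \<otimes> \<xi>)"
      using ab(1,2)[THEN K_carrier] i(1)[THEN K_carrier] xi_closed by algebra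
    finally have "diff_class F K z = diff_class F K (\<one> \<oplus> (inv a \<otimes> b) \<otimes> \<xi>)"
      using diff_class_smult[of a "\<one> \<oplus> (inv a \<otimes> b) \<otimes> \<xi>"] ab i False by simp
    then show ?thesis using ab i by (auto simp: diff_set_def)
  qed
qed

section \<open>The graph isomorphism\<close>

lemma scale_vec_K [simp]: "scale_vec (F\<lparr>carrier := K\<rparr>) c x = scale_vec F c x"
  by (cases x) simp

lemma dot_vec_K [simp]: "dot_vec (F\<lparr>carrier := K\<rparr>) x y = dot_vec F x y"
  by (cases x; cases y) simp

lemma nonzero_vecs_K: "nonzero_vecs (F\<lparr>carrier := K\<rparr>) = K \<times> K \<times> K - {(\<zero>, \<zero>, \<zero>)}"
  by (simp add: nonzero_vecs_def)

lemma scale_vec_closed: "\<lbrakk>c \<in> K; x \<in> K \<times> K \<times> K\<rbrakk> \<Longrightarrow> scale_vec F c x \<in> K \<times> K \<times> K"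
  by (cases x) simp

text \<open>The coordinate bijection commutes with scalars, so it matches projective points with
  classes modulo the nonzero scalars. Under this matching both adjacency relations say that the
  vertices differ and that representatives have dot product zero.\<close>

lemma digraph_iso_diff_brown:
  "digraph_iso (with_proj (diff_graph F K \<xi>)) (with_proj (brown_graph (F\<lparr>carrier := K\<rparr>)))"
proof -
  let ?V = "K \<times> K \<times> K" and ?K = "F\<lparr>carrier := K\<rparr>"
  obtain \<phi> where bij: "bij_betw \<phi> ?V (carrier F)" and \<phi>0: "\<phi> (\<zero>, \<zero>, \<zero>) = \<zero>"
    and scale: "\<And>c x. \<lbrakk>c \<in> K; x \<in> ?V\<rbrakk> \<Longrightarrow> \<phi> (scale_vec F c x) = c \<otimes> \<phi> x"
    and dot: "\<And>x y. \<lbrakk>x \<in> ?V; y \<in> ?V\<rbrakk> \<Longrightarrow> \<phi> x \<otimes> \<phi> y \<in> affine_span F K \<xi> \<longleftrightarrow> dot_vec F x y = \<zero>"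
    using polarity_coordinates by metis
  have inj: "\<phi> x = \<phi> y \<longleftrightarrow> x = y" if "x \<in> ?V" "y \<in> ?V" for x y
    using bij that by (auto simp: bij_betw_def dest: inj_onD)
  have \<phi>V: "\<phi> x \<in> carrier F" if "x \<in> ?V" for x
    using bij that by (auto simp: bij_betw_def)
  let ?N = "nonzero_vecs ?K"
  have NV: "x \<in> ?V" if "x \<in> ?N" for x using that unfolding nonzero_vecs_K by blast
  have \<phi>_nonzero: "\<phi> x \<noteq> \<zero> \<longleftrightarrow> x \<in> ?N" if "x \<in> ?V" for x
    using that inj[of x "(\<zero>, \<zero>, \<zero>)"] unfolding nonzero_vecs_K \<phi>0 by simp
  have \<phi>N: "\<phi> x \<in> carrier F - {\<zero>}" if "x \<in> ?N" for x
    using that \<phi>_nonzero NV \<phi>V by simp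
  have \<phi>_image: "\<phi> ` ?N = carrier F - {\<zero>}"
  proof
    show "carrier F - {\<zero>} \<subseteq> \<phi> ` ?N"
    proof
      fix z assume z: "z \<in> carrier F - {\<zero>}"
      then have "z \<in> \<phi> ` ?V" using bij by (simp add: bij_betw_def)
      then obtain x where "x \<in> ?V" "z = \<phi> x" by blast
      then show "z \<in> \<phi> ` ?N" using z \<phi>_nonzero by blast
    qed
    show "\<phi> ` ?N \<subseteq> carrier F - {\<zero>}" using \<phi>N by (rule image_subsetI)
  qed
  define pt where "pt x = proportional ?K `` {x}" for x
  \<comment> \<open>Taking preimages under \<open>\<phi>\<close> sends a class to a projective point
    without choosing representatives.\<close>
  define f where "f A = {x \<in> ?V. \<phi> x \<in> A}" for A
  have verts: "pverts (diff_graph F K \<xi>) = (\<lambda>x. diff_class F K (\<phi> x)) ` ?N"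
    by (simp add: diff_graph_def carrier_diff_group \<phi>_image[symmetric] image_image)
  have verts': "pverts (brown_graph ?K) = pt ` ?N"
    by (auto simp: brown_graph_def proj_points_def quotient_def pt_def)
  have f: "f (diff_class F K (\<phi> x)) = pt x" if x: "x \<in> ?N" for x
  proof -
    have "y \<in> ?V \<and> \<phi> y \<in> diff_class F K (\<phi> x) \<longleftrightarrow> (x, y) \<in> proportional ?K" for y
    proof
      assume y: "y \<in> ?V \<and> \<phi> y \<in> diff_class F K (\<phi> x)"
      then obtain c where c: "c \<in> K - {\<zero>}" "\<phi> y = c \<otimes> \<phi> x" by (auto simp: mem_diff_class)
      then have "\<phi> y = \<phi> (scale_vec F c x)" using scale NV[OF x] by simp
      then have "y = scale_vec F c x" using y c scale_vec_closed NV[OF x] inj by simp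
      moreover have "\<phi> y \<noteq> \<zero>" using c \<phi>N[OF x] by (auto simp: integral_iff)
      then have "y \<in> ?N" using y \<phi>_nonzero by blast
      ultimately show "(x, y) \<in> proportional ?K" using x c by (auto simp: proportional_def)
    next
      assume "(x, y) \<in> proportional ?K"
      then obtain c where "c \<in> K - {\<zero>}" "y = scale_vec F c x" "y \<in> ?N"
        by (auto simp: proportional_def)
      then show "y \<in> ?V \<and> \<phi> y \<in> diff_class F K (\<phi> x)"
        using NV scale x by (auto simp: mem_diff_class)
    qed
    then show ?thesis by (auto simp: f_def pt_def)
  qed
  have mem_f: "x \<in> f A \<longleftrightarrow> \<phi> x \<in> A" if "x \<in> ?N" for x A using NV[OF that] by (simp add: f_def)
  have mem_pt: "w \<in> pt x \<longleftrightarrow> w \<in> ?V \<and> \<phi> w \<in> diff_class F K (\<phi> x)" if "x \<in> ?N" for w x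
    unfolding f[OF that, symmetric] f_def by simp
  \<comment> \<open>This gives the injectivity of \<open>f\<close> and also matches the suppressed
    loops of the two graphs.\<close>
  have pt_eq: "pt x = pt y \<longleftrightarrow> diff_class F K (\<phi> x) = diff_class F K (\<phi> y)"
    if "x \<in> ?N" "y \<in> ?N" for x y
  proof
    assume "pt x = pt y"
    then have "f (diff_class F K (\<phi> x)) = f (diff_class F K (\<phi> y))" using f that by simp
    moreover have "\<phi> x \<in> diff_class F K (\<phi> x)" using diff_class_self \<phi>N[OF that(1)] by simp
    ultimately have "\<phi> x \<in> diff_class F K (\<phi> y)" using mem_f[OF that(1)] by metis
    then show "diff_class F K (\<phi> x) = diff_class F K (\<phi> y)"
      using \<phi>N that by (simp add: diff_class_eq_iff)
  qed (use f that in metis)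
  have arc: "(diff_class F K (\<phi> x), diff_class F K (\<phi> y)) \<in> parcs (diff_graph F K \<xi>) \<longleftrightarrow>
      diff_class F K (\<phi> x) \<noteq> diff_class F K (\<phi> y) \<and> dot_vec F x y = \<zero>"
    if "x \<in> ?N" "y \<in> ?N" for x y
  proof -
    have "\<phi> x \<otimes> \<phi> y \<in> carrier F - {\<zero>}" using \<phi>N that by (simp add: integral_iff)
    then show ?thesis
      using \<phi>N[OF that(1)] \<phi>N[OF that(2)] dot[OF NV NV, OF that]
      by (auto simp: diff_graph_def carrier_diff_group mult_diff_class diff_class_in_diff_set_iff)
  qed
  have arc': "(pt x, pt y) \<in> parcs (brown_graph ?K) \<longleftrightarrow> pt x \<noteq> pt y \<and> dot_vec F x y = \<zero>"
    if xy: "x \<in> ?N" "y \<in> ?N" for x y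
  proof -
    have self: "x \<in> pt x" if "x \<in> ?N" for x
      using mem_pt[OF that] NV[OF that] \<phi>N[OF that] diff_class_self by simp
    \<comment> \<open>Adjacency in the Brown graph only provides some representatives. Independence
      of the choice is inherited from the quotient group: the class of the product depends only on
      the classes of the factors, and membership in the difference set only on that class.\<close>
    have "dot_vec F x y = \<zero>" if "x' \<in> pt x" "y' \<in> pt y" "dot_vec F x' y' = \<zero>" for x' y'
    proof -
      have *: "x' \<in> ?V" "y' \<in> ?V" "\<phi> x' \<in> diff_class F K (\<phi> x)" "\<phi> y' \<in> diff_class F K (\<phi> y)"
        using that(1,2) mem_pt xy by simp_all
      then have "diff_class F K (\<phi> x') = diff_class F K (\<phi> x)" "diff_class F K (\<phi> y') = diff_class F K (\<phi> y)"
        using \<phi>N xy \<phi>V by (simp_all add: diff_class_eq_iff)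
      moreover have N: "x' \<in> ?N" "y' \<in> ?N"
        using that(1,2) by (auto simp: pt_def proportional_def)
      ultimately have "diff_class F K (\<phi> x' \<otimes> \<phi> y') = diff_class F K (\<phi> x \<otimes> \<phi> y)"
        using mult_diff_class[OF \<phi>N \<phi>N] xy N by metis
      moreover have "\<phi> x' \<otimes> \<phi> y' \<in> carrier F - {\<zero>}" "\<phi> x \<otimes> \<phi> y \<in> carrier F - {\<zero>}"
        using \<phi>N xy N by (simp_all add: integral_iff)
      ultimately have "\<phi> x \<otimes> \<phi> y \<in> affine_span F K \<xi> \<longleftrightarrow> \<phi> x' \<otimes> \<phi> y' \<in> affine_span F K \<xi>"
        using diff_class_in_diff_set_iff by (metis DiffD1 DiffD2 singletonI)
      then show ?thesis using dot that(3) * NV xy by simp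
    qed
    then show ?thesis
      using xy self[OF xy(1)] self[OF xy(2)] verts' by (auto simp: brown_graph_def)
  qed
  show ?thesis
  proof (rule digraph_iso_with_projI[where f = f])
    show "bij_betw f (pverts (diff_graph F K \<xi>)) (pverts (brown_graph ?K))"
      unfolding bij_betw_def
    proof
      show "inj_on f (pverts (diff_graph F K \<xi>))"
        unfolding verts by (rule inj_onI) (use f pt_eq in auto)
      show "f ` pverts (diff_graph F K \<xi>) = pverts (brown_graph ?K)"
        unfolding verts verts' image_image using f by (rule image_cong[OF refl])
    qed
    fix a b assume "a \<in> pverts (diff_graph F K \<xi>)" "b \<in> pverts (diff_graph F K \<xi>)"
    then obtain x y where "x \<in> ?N" "a = diff_class F K (\<phi> x)" "y \<in> ?N" "b = diff_class F K (\<phi> y)"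
      unfolding verts by blast
    then show "(a, b) \<in> parcs (diff_graph F K \<xi>) \<longleftrightarrow> (f a, f b) \<in> parcs (brown_graph ?K)"
      using arc arc' f pt_eq by simp
  qed (auto simp: diff_graph_def brown_graph_def)
qed

end

theorem theorem4:
  fixes F :: "('a, 'm) ring_scheme" and K :: "'a set" and \<xi> :: 'a and q :: nat
  assumes "primepow q"
    and "field F" and "card (carrier F) = q ^ 3"
    and "subfield K F" and "card K = q"
    and "primitive_element F \<xi>"
  shows "digraph_iso (with_proj (diff_graph F K \<xi>)) (with_proj (brown_graph (F\<lparr>carrier := K\<rparr>)))"
proof -
  \<comment> \<open>Infinite sets have \<open>card\<close> zero, so a positive value yields
    finiteness.\<close>
  have "0 < card (carrier F)"
    using assms(1,3) by (simp add: primepow_gt_0_nat)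
  then have "finite (carrier F)" by (rule card_ge_0_finite)
  then have "cubic_extension F K \<xi>"
    using assms by (simp add: cubic_extension_def cubic_extension_axioms_def)
  then show ?thesis by (rule cubic_extension.digraph_iso_diff_brown)
qed

end
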